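(* Let $f\colon\mathbb{R}\to\mathbb{R}$ be a function with the following properties: (i) $f$ is a Newton's function, that is, $f$ is of class $\mathcal{C}^2(\mathbb{R})$; for every $x\in\mathbb{R}$, if $f(x)=0$ then $f'(x)\neq 0$; and for every $x\in\mathbb{R}$, if $f'(x)=0$ then $f''(x)\neq 0$. (ii) $f$ has infinite limits of opposite signs at $\pm\infty$: either $\lim_{x\to+\infty}f(x)=+\infty$ and $\lim_{x\to-\infty}f(x)=-\infty$, or $\lim_{x\to+\infty}f(x)=-\infty$ and $\lim_{x\to-\infty}f(x)=+\infty$. (iii) $f$ has at least four (distinct) real roots. Let $M_f$ be the modified Newton's approximation function of $f$. Then: (a) $M_f$ has periodic points of any prime period, that is, for every integer $n\geq 1$ there is a periodic point of $M_f$ of prime period $n$. (b) The set of all real numbers $a$ for which the sequence $(M_f^n(a))_{n\in\mathbb{N}}$ does not converge is uncountable.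
   Context: For a differentiable function $f\colon\mathbb{R}\to\mathbb{R}$, the classical Newton's approximation function is $N_f(x)=x-\frac{f(x)}{f'(x)}$, and the modified Newton's approximation function is $M_f(x)=N_f(x)-\frac{f(N_f(x))}{f'(x)}$; both are defined for all $x\in\mathbb{R}$ with $f'(x)\neq 0$. $M_f^n$ denotes the $n$-fold iterate of $M_f$. Since $M_f$ is only partially defined, $M_f^n(a)$ makes sense when $f'(M_f^i(a))\neq 0$ for all $0\le i<n$ (with $M_f^0(a)=a$). A periodic point of $M_f$ is a point $a$ such that, for some integer $n\geq 1$, $M_f^n(a)$ is defined and $M_f^n(a)=a$; the least such $n$ is its prime period. In (b), the points $a$ considered are those for which $M_f^n(a)$ is defined for all $n\in\mathbb{N}$ and the resulting sequence of real numbers does not converge in $\mathbb{R}$. *)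

theory Defs
  imports "HOL-Analysis.Analysis"
begin

definition C2 :: "(real \<Rightarrow> real) \<Rightarrow> bool" where
  "C2 f \<longleftrightarrow> (\<forall>x. f differentiable (at x)) \<and> (\<forall>x. deriv f differentiable (at x)) \<and>
     continuous_on UNIV (deriv (deriv f))"

definition newton_function :: "(real \<Rightarrow> real) \<Rightarrow> bool" where
  "newton_function f \<longleftrightarrow> C2 f \<and>
     (\<forall>x. f x = 0 \<longrightarrow> deriv f x \<noteq> 0) \<and>
     (\<forall>x. deriv f x = 0 \<longrightarrow> deriv (deriv f) x \<noteq> 0)"

(* The approximation functions are partial: their values at zeros of deriv f are meaningless
   (they come from the convention x / 0 = 0).  Every use of an iterate below is therefore
   guarded by iterate_defined. *)

definition newton_approx :: "(real \<Rightarrow> real) \<Rightarrow> real \<Rightarrow> real" where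
  "newton_approx f x = x - f x / deriv f x"

definition modified_newton_approx :: "(real \<Rightarrow> real) \<Rightarrow> real \<Rightarrow> real" where
  "modified_newton_approx f x = newton_approx f x - f (newton_approx f x) / deriv f x"

definition iterate_defined :: "(real \<Rightarrow> real) \<Rightarrow> nat \<Rightarrow> real \<Rightarrow> bool" where
  "iterate_defined f n a \<longleftrightarrow> (\<forall>i<n. deriv f ((modified_newton_approx f ^^ i) a) \<noteq> 0)"

definition has_period :: "(real \<Rightarrow> real) \<Rightarrow> real \<Rightarrow> nat \<Rightarrow> bool" where
  "has_period f a n \<longleftrightarrow> n \<ge> 1 \<and> iterate_defined f n a \<and> (modified_newton_approx f ^^ n) a = a"

definition has_prime_period :: "(real \<Rightarrow> real) \<Rightarrow> real \<Rightarrow> nat \<Rightarrow> bool" where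
  "has_prime_period f a n \<longleftrightarrow> has_period f a n \<and> (\<forall>m. has_period f a m \<longrightarrow> n \<le> m)"

end

theory Submission
  imports Defs
begin

text \<open>
  Two adjacent interior roots of \<open>f\<close> lie in disjoint bounded intervals whose end points are zeros
  of the derivative and which contain no other zero of it.  At either end the Newton step blows up to
  infinity, hence so does \<open>f\<close> of it, and because the limits of \<open>f\<close> have opposite signs the modified
  map tends to opposite infinities at the two ends.  Shrinking both intervals slightly gives
  two disjoint compact intervals, each of which is mapped onto a superset of their union: a
  horseshoe.  Every sequence of two symbols is then the itinerary of a point, and a
  periodic itinerary is realised by a periodic point.
\<close>

section \<open>Covering relations between intervals\<close>

lemma compact_Icc_vimage_singleton:
  fixes g :: "real \<Rightarrow> real"
  assumes "continuous_on {a..b} g"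
  shows "compact ({a..b} \<inter> g -` {p})"
proof -
  have "closed ({a..b} \<inter> g -` {p})" by (intro continuous_closed_preimage assms) auto
  then have "compact ({a..b} \<inter> ({a..b} \<inter> g -` {p}))" by (intro compact_Int_closed) auto
  then show ?thesis by (simp add: Int_assoc[symmetric])
qed

text \<open>Take \<open>a\<close> as the last point where \<open>g\<close> equals \<open>p\<close>,
  then \<open>b\<close> as the first later point where \<open>g\<close> equals \<open>q\<close>.
  Between them \<open>g\<close> cannot leave \<open>{p..q}\<close>, since by the intermediate value
  theorem it would have to take the value \<open>p\<close> or \<open>q\<close> once more.\<close>

lemma covering_subinterval_oriented:
  fixes g :: "real \<Rightarrow> real"
  assumes "u \<le> v" "continuous_on {u..v} g" "g u = p" "g v = q" "p \<le> q"
  shows "\<exists>a b. a \<le> b \<and> {a..b} \<subseteq> {u..v} \<and> g ` {a..b} = {p..q}"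
proof -
  define A where "A = {u..v} \<inter> g -` {p}"
  have "compact A" unfolding A_def by (rule compact_Icc_vimage_singleton) (fact assms(2))
  moreover have "u \<in> A" using assms by (auto simp: A_def)
  ultimately obtain a where a: "a \<in> A" "\<forall>x\<in>A. x \<le> a"
    using compact_attains_sup[of A] by blast
  have av: "u \<le> a" "a \<le> v" "g a = p" using a by (auto simp: A_def)
  have ca: "continuous_on {a..v} g" using av by (intro continuous_on_subset[OF assms(2)]) auto
  define B where "B = {a..v} \<inter> g -` {q}"
  have "compact B" unfolding B_def by (rule compact_Icc_vimage_singleton) (fact ca)
  moreover have "v \<in> B" using assms av by (auto simp: B_def)
  ultimately obtain b where b: "b \<in> B" "\<forall>x\<in>B. b \<le> x"
    using compact_attains_inf[of B] by blast
  have bv: "a \<le> b" "b \<le> v" "g b = q" using b by (auto simp: B_def)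
  have cab: "continuous_on {a..b} g" using bv by (intro continuous_on_subset[OF ca]) auto
  have "{p..q} \<subseteq> g ` {a..b}"
  proof
    fix y assume "y \<in> {p..q}"
    then show "y \<in> g ` {a..b}" using IVT'[of g a y b] cab av bv by auto
  qed
  moreover have "g x \<in> {p..q}" if x: "x \<in> {a..b}" for x
  proof (rule ccontr)
    assume "g x \<notin> {p..q}"
    then consider "g x < p" | "g x > q" by fastforce
    then show False
    proof cases
      \<comment> \<open>To climb from below \<open>p\<close> up to \<open>q\<close> at
        \<open>b\<close>, \<open>g\<close> must take the value \<open>p\<close> again, against the
        choice of \<open>a\<close> as the last such point.\<close>
      case 1
      have "continuous_on {x..b} g" using x by (intro continuous_on_subset[OF cab]) auto
      then obtain z where z: "x \<le> z" "z \<le> b" "g z = p"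
        using IVT'[of g x p b] 1 bv x assms by auto
      then have "z \<in> A" using x av bv by (auto simp: A_def)
      then have "z = x" using a x z by force
      then show False using z 1 by auto
    next
      case 2
      have "continuous_on {a..x} g" using x by (intro continuous_on_subset[OF cab]) auto
      then obtain z where z: "a \<le> z" "z \<le> x" "g z = q"
        using IVT'[of g a q x] 2 av x assms by auto
      then have "z \<in> B" using x av bv by (auto simp: B_def)
      then have "z = x" using b x z by force
      then show False using z 2 by auto
    qed
  qed
  ultimately have "g ` {a..b} = {p..q}" by blast
  then show ?thesis using av bv by (intro exI[of _ a] exI[of _ b]) auto
qed

text \<open>Preimages of \<open>p\<close> and \<open>q\<close> may come in either order; the
  reversed order is reduced to the oriented case by passing to \<open>- g\<close>.\<close>

lemma covering_subinterval:
  fixes g :: "real \<Rightarrow> real"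
  assumes "continuous_on {c..d} g" "{p..q} \<subseteq> g ` {c..d}" "p \<le> q"
  shows "\<exists>a b. a \<le> b \<and> {a..b} \<subseteq> {c..d} \<and> g ` {a..b} = {p..q}"
proof -
  have "p \<in> g ` {c..d}" "q \<in> g ` {c..d}" using assms by auto
  then obtain u v where uv: "u \<in> {c..d}" "g u = p" "v \<in> {c..d}" "g v = q" by auto
  show ?thesis
  proof (cases "u \<le> v")
    case True
    moreover have "{u..v} \<subseteq> {c..d}" using uv by auto
    moreover from this have "continuous_on {u..v} g" by (rule continuous_on_subset[OF assms(1)])
    ultimately show ?thesis
      using covering_subinterval_oriented[of u v g p q] uv assms by (meson order_trans)
  next
    case False
    have sub: "{v..u} \<subseteq> {c..d}" using uv by auto
    then have "continuous_on {v..u} (\<lambda>x. - g x)"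
      by (intro continuous_on_minus continuous_on_subset[OF assms(1)])
    then obtain a b where ab: "a \<le> b" "{a..b} \<subseteq> {v..u}" "(\<lambda>x. - g x) ` {a..b} = {-q..-p}"
      using covering_subinterval_oriented[of v u "\<lambda>x. - g x" "-q" "-p"] uv assms False
      by (metis linear neg_le_iff_le)
    have "g ` {a..b} = uminus ` (\<lambda>x. - g x) ` {a..b}" by (simp add: image_image)
    then have "g ` {a..b} = {p..q}" by (simp add: ab)
    then show ?thesis using ab sub by (meson order_trans)
  qed
qed

text \<open>The induction removes the first interval: the shifted chain yields \<open>{p..q}\<close>
  inside the second interval, which is then pulled back along \<open>g\<close>. Having exact images
  rather than mere coverings keeps whole orbits inside the prescribed intervals.\<close>

lemma covering_chain:
  fixes g :: "real \<Rightarrow> real"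
  assumes "\<And>i. i < n \<Longrightarrow> continuous_on {lo i..hi i} g"
    and "\<And>i. i < n \<Longrightarrow> {lo (Suc i)..hi (Suc i)} \<subseteq> g ` {lo i..hi i}"
    and "lo n \<le> hi n"
  shows "\<exists>a b. a \<le> b \<and> (\<forall>x\<in>{a..b}. \<forall>i\<le>n. (g ^^ i) x \<in> {lo i..hi i}) \<and>
           continuous_on {a..b} (g ^^ n) \<and> (g ^^ n) ` {a..b} = {lo n..hi n}"
  using assms
proof (induction n arbitrary: lo hi)
  case 0
  then show ?case by (intro exI[of _ "lo 0"] exI[of _ "hi 0"]) (auto simp: id_def)
next
  case (Suc n)
  obtain p q where pq: "p \<le> q" "\<forall>x\<in>{p..q}. \<forall>i\<le>n. (g ^^ i) x \<in> {lo (Suc i)..hi (Suc i)}"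
    "continuous_on {p..q} (g ^^ n)" "(g ^^ n) ` {p..q} = {lo (Suc n)..hi (Suc n)}"
    using Suc.IH[of "\<lambda>i. lo (Suc i)" "\<lambda>i. hi (Suc i)"] Suc.prems by auto
  have "{p..q} \<subseteq> {lo (Suc 0)..hi (Suc 0)}"
  proof
    fix x assume "x \<in> {p..q}"
    then show "x \<in> {lo (Suc 0)..hi (Suc 0)}" using pq(2) by (metis funpow_0 le0)
  qed
  then have "{p..q} \<subseteq> g ` {lo 0..hi 0}" using Suc.prems(2)[of 0] by auto
  then obtain a b where ab: "a \<le> b" "{a..b} \<subseteq> {lo 0..hi 0}" "g ` {a..b} = {p..q}"
    using covering_subinterval[of "lo 0" "hi 0" g p q] pq(1) Suc.prems(1)[of 0] by auto
  have "(g ^^ i) x \<in> {lo i..hi i}" if "x \<in> {a..b}" "i \<le> Suc n" for x i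
  proof (cases i)
    case 0
    then show ?thesis using that ab by auto
  next
    case (Suc j)
    have "g x \<in> {p..q}" using that ab by auto
    then show ?thesis using pq(2) Suc that by (simp add: funpow_swap1)
  qed
  moreover have "continuous_on {a..b} g"
    using ab(2) by (intro continuous_on_subset[OF Suc.prems(1)[of 0]]) auto
  then have "continuous_on {a..b} (g ^^ Suc n)"
    unfolding funpow_Suc_right using ab pq by (intro continuous_on_compose) auto
  moreover have "(g ^^ Suc n) ` {a..b} = {lo (Suc n)..hi (Suc n)}"
    unfolding funpow_Suc_right using ab pq by (metis image_comp)
  ultimately show ?case using ab(1) by blast
qed

text \<open>When the chain closes up, \<open>g ^^ n\<close> maps \<open>{a..b}\<close> onto an
  interval that contains \<open>{a..b}\<close>, so \<open>(g ^^ n) x - x\<close> changes sign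
  there.\<close>

lemma covering_cycle_periodic_point:
  fixes g :: "real \<Rightarrow> real"
  assumes "\<And>i. i < n \<Longrightarrow> continuous_on {lo i..hi i} g"
    and "\<And>i. i < n \<Longrightarrow> {lo (Suc i)..hi (Suc i)} \<subseteq> g ` {lo i..hi i}"
    and "lo n \<le> hi n" "lo n = lo 0" "hi n = hi 0"
  shows "\<exists>x. (g ^^ n) x = x \<and> (\<forall>i\<le>n. (g ^^ i) x \<in> {lo i..hi i})"
proof -
  obtain a b where ab: "a \<le> b" "\<forall>x\<in>{a..b}. \<forall>i\<le>n. (g ^^ i) x \<in> {lo i..hi i}"
    "continuous_on {a..b} (g ^^ n)" "(g ^^ n) ` {a..b} = {lo n..hi n}"
    using covering_chain[OF assms(1,2,3)] by blast
  have sub: "x \<in> {lo n..hi n}" if "x \<in> {a..b}" for x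
    using ab(2) that assms(4,5) by (metis funpow_0 le0)
  have "lo n \<in> (g ^^ n) ` {a..b}" "hi n \<in> (g ^^ n) ` {a..b}" using ab(4) assms(3) by auto
  then obtain u v where uv: "u \<in> {a..b}" "(g ^^ n) u = lo n" "v \<in> {a..b}" "(g ^^ n) v = hi n"
    by force
  define h where "h = (\<lambda>x. (g ^^ n) x - x)"
  have "continuous_on {a..b} h" unfolding h_def using ab(3) by (intro continuous_intros)
  then have "connected (h ` {a..b})" by (rule connected_continuous_image) simp
  moreover have "h u \<le> 0" "0 \<le> h v" using sub uv by (auto simp: h_def)
  ultimately have "0 \<in> h ` {a..b}" using uv by (meson connectedD_interval image_eqI)
  then show ?thesis using ab(2) by (auto simp: h_def)
qed

section \<open>Itineraries in a horseshoe\<close>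

text \<open>The points that follow the itinerary up to time \<open>n\<close> form a decreasing
  sequence of nonempty compact sets.\<close>

lemma itinerary_point:
  fixes g :: "'a::heine_borel \<Rightarrow> 'a" and J :: "'b \<Rightarrow> 'a set"
  assumes "\<And>k. compact (J k)" "\<And>k. J k \<noteq> {}" "\<And>k. continuous_on (J k) g"
    and "\<And>k l. J k \<subseteq> g ` J l"
  shows "\<exists>x. \<forall>i. (g ^^ i) x \<in> J (s i)"
proof -
  define A where "A n t = {x. \<forall>i\<le>n. (g ^^ i) x \<in> J (t i)}" for n and t :: "nat \<Rightarrow> 'b"
  \<comment> \<open>Splitting off the first symbol replaces iterates by a single preimage under
    \<open>g\<close>; the induction below therefore needs arbitrary itineraries
    \<open>t\<close>.\<close>
  have A_Suc: "A (Suc n) t = J (t 0) \<inter> g -` A n (\<lambda>i. t (Suc i))" for n t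
  proof (intro set_eqI iffI)
    fix x assume "x \<in> A (Suc n) t"
    then show "x \<in> J (t 0) \<inter> g -` A n (\<lambda>i. t (Suc i))"
      unfolding A_def by (auto simp: funpow_swap1 dest: spec[of _ 0] spec[of _ "Suc _"])
  next
    fix x assume x: "x \<in> J (t 0) \<inter> g -` A n (\<lambda>i. t (Suc i))"
    have "(g ^^ i) x \<in> J (t i)" if "i \<le> Suc n" for i
      using that x by (cases i) (auto simp: A_def funpow_swap1)
    then show "x \<in> A (Suc n) t" by (simp add: A_def)
  qed
  have ne: "compact (A n t) \<and> A n t \<noteq> {}" for n t
  proof (induction n arbitrary: t)
    case 0
    have "A 0 t = J (t 0)" by (auto simp: A_def)
    then show ?case using assms by simp
  next
    case (Suc n)
    let ?B = "A n (\<lambda>i. t (Suc i))"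
    have B: "compact ?B" "?B \<noteq> {}" using Suc by auto
    have "closed (J (t 0) \<inter> g -` ?B)"
      using continuous_closed_preimage[OF assms(3)] B(1) assms(1) compact_imp_closed by blast
    then have "compact (J (t 0) \<inter> (J (t 0) \<inter> g -` ?B))"
      using assms(1) compact_Int_closed by blast
    \<comment> \<open>\<open>?B\<close> lies in the set of the second symbol, which the covering
      hypothesis places in the image of the first; so the preimage is nonempty.\<close>
    moreover have "?B \<subseteq> g ` J (t 0)"
      using assms(4)[of "t (Suc 0)" "t 0"] by (auto simp: A_def dest: spec[of _ 0])
    ultimately show ?case using B by (auto simp: A_Suc)
  qed
  have "A n s \<subseteq> A m s" if "m \<le> n" for m n using that by (auto simp: A_def)
  then have "\<Inter> (range (\<lambda>n. A n s)) \<noteq> {}" using ne by (intro compact_nest[of "\<lambda>n. A n s"]) simp_all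
  then show ?thesis by (auto simp: A_def)
qed

text \<open>Each set of naturals is coded into an itinerary. As the two sets are disjoint, the orbit
  determines its itinerary, so distinct sets give distinct points, and Cantor's theorem
  applies.\<close>

lemma uncountable_nonconvergent_orbits:
  fixes g :: "'a::heine_borel \<Rightarrow> 'a" and J :: "bool \<Rightarrow> 'a set"
  assumes "\<And>k. compact (J k)" "\<And>k. J k \<noteq> {}" "\<And>k. continuous_on (J k) g"
    and "\<And>k l. J k \<subseteq> g ` J l" and "J True \<inter> J False = {}"
  shows "uncountable {x. (\<forall>i. (g ^^ i) x \<in> J True \<union> J False) \<and> \<not> convergent (\<lambda>i. (g ^^ i) x)}"
    (is "uncountable ?S")
proof
  assume count: "countable ?S"
  \<comment> \<open>Odd positions carry an arbitrary set; even positions alternate and so prevent convergence.\<close>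
  define s where "s T i = (if odd i then i div 2 \<in> T else even (i div 2))" for T :: "nat set" and i
  have "\<forall>T. \<exists>x. \<forall>i. (g ^^ i) x \<in> J (s T i)" using itinerary_point[of J g] assms by blast
  then obtain X where X: "\<And>T i. (g ^^ i) (X T) \<in> J (s T i)" by metis
  have "X T \<in> ?S" for T
  proof -
    have "(g ^^ i) (X T) \<in> J True \<union> J False" for i using X[of i T] by (cases "s T i") auto
    moreover have "\<not> convergent (\<lambda>i. (g ^^ i) (X T))"
    proof
      assume "convergent (\<lambda>i. (g ^^ i) (X T))"
      then obtain L where L: "(\<lambda>i. (g ^^ i) (X T)) \<longlonglongrightarrow> L" by (auto simp: convergent_def)
      have "L \<in> J k" if "strict_mono r" "\<And>j. s T (r j) = k" for r :: "nat \<Rightarrow> nat" and k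
      proof (rule Lim_in_closed_set)
        show "closed (J k)" using assms compact_imp_closed by blast
        show "((\<lambda>i. (g ^^ i) (X T)) \<circ> r) \<longlonglongrightarrow> L" using L that by (metis LIMSEQ_subseq_LIMSEQ)
        show "\<forall>\<^sub>F j in sequentially. ((\<lambda>i. (g ^^ i) (X T)) \<circ> r) j \<in> J k"
        proof (rule always_eventually, rule allI)
          fix j show "((\<lambda>i. (g ^^ i) (X T)) \<circ> r) j \<in> J k" using X[of "r j" T] that(2)[of j] by simp
        qed
      qed simp
      \<comment> \<open>Half of \<open>4 * j\<close> is even and half of \<open>4 * j + 2\<close> is
        odd, so these two subsequences carry constant, opposite symbols.\<close>
      from this[of "\<lambda>j. 4 * j" True] this[of "\<lambda>j. 4 * j + 2" False]
      have "L \<in> J True" "L \<in> J False" by (auto simp: s_def strict_mono_def)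
      then show False using assms(5) by auto
    qed
    ultimately show ?thesis by blast
  qed
  then have "range X \<subseteq> ?S" by (rule image_subsetI)
  then have "countable (range X)" by (rule countable_subset) (rule count)
  moreover have "inj X"
  proof (rule injI)
    fix T U assume eq: "X T = X U"
    have "s T i = s U i" for i
      using X[of i T] X[of i U] assms(5) unfolding eq by (cases "s T i"; cases "s U i") auto
    \<comment> \<open>The symbol at position \<open>2 * k + 1\<close> records whether
      \<open>k\<close> belongs to the coded set.\<close>
    then have "s T (2 * k + 1) = s U (2 * k + 1)" for k by blast
    then show "T = U" by (auto simp: s_def)
  qed
  ultimately have "countable (UNIV :: nat set set)"
    by (rule countable_image_inj_on)
  then obtain h :: "nat \<Rightarrow> nat set" where "range h = UNIV"
    by (metis UNIV_not_empty uncountable_def)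
  then show False using Cantors_theorem[of "UNIV :: nat set"] by (metis Pow_UNIV)
qed

section \<open>The modified Newton map between two critical points\<close>

lemma continuous_on_if_differentiable:
  fixes f :: "real \<Rightarrow> real"
  assumes "\<And>x. f differentiable (at x)"
  shows "continuous_on S f"
  using assms by (intro continuous_at_imp_continuous_on ballI differentiable_imp_continuous_within)

lemma deriv_uminus:
  fixes f :: "real \<Rightarrow> real"
  assumes "\<And>x. f differentiable (at x)"
  shows "deriv (\<lambda>x. - f x) = (\<lambda>x. - deriv f x)"
proof
  fix x
  have "(f has_real_derivative deriv f x) (at x)"
    using assms by (simp add: DERIV_deriv_iff_real_differentiable)
  then show "deriv (\<lambda>x. - f x) x = - deriv f x" by (intro DERIV_imp_deriv DERIV_minus)
qed

text \<open>A change of sign cancels in both quotients. This allows the derivative to be taken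
  positive between two critical points.\<close>

lemma modified_newton_approx_uminus:
  assumes "\<And>x. f differentiable (at x)"
  shows "modified_newton_approx (\<lambda>x. - f x) = modified_newton_approx f"
  by (rule ext) (simp add: modified_newton_approx_def newton_approx_def deriv_uminus[OF assms])

text \<open>Both corrections are merged into one product, the form in which the limit rules apply.
  The convention \<open>x / 0 = 0\<close> makes the identity unconditional.\<close>

lemma modified_newton_approx_alt:
  "modified_newton_approx f x = x - (f x + f (newton_approx f x)) * inverse (deriv f x)"
  by (simp add: modified_newton_approx_def newton_approx_def field_simps add_divide_distrib)

text \<open>\<open>F\<close> stands for a one-sided neighbourhood of a critical point
  \<open>e\<close>, with \<open>L\<close> the value of \<open>f\<close> there. As the derivative
  tends to zero from above, the sign of \<open>L\<close> decides at which infinity \<open>G\<close>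
  the Newton step escapes; the limit of \<open>f\<close> along \<open>G\<close> then decides the
  sign of the modified step.\<close>

lemma modified_newton_unbounded_near:
  fixes f :: "real \<Rightarrow> real"
  assumes lim: "((\<lambda>x. x) \<longlongrightarrow> e) F" "(f \<longlongrightarrow> L) F" "(deriv f \<longlongrightarrow> 0) F"
    and pos: "\<forall>\<^sub>F x in F. deriv f x > 0"
    and "L < 0 \<and> G = at_top \<or> L > 0 \<and> G = at_bot"
  shows "filterlim f at_top G \<Longrightarrow> filterlim (modified_newton_approx f) at_bot F"
    and "filterlim f at_bot G \<Longrightarrow> filterlim (modified_newton_approx f) at_top F"
proof -
  have inv: "filterlim (\<lambda>x. inverse (deriv f x)) at_top F"
    using filterlim_inverse_at_top[OF lim(3) pos] .
  have N: "filterlim (newton_approx f) G F"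
    using assms(5)
  proof (elim disjE conjE)
    assume "L < 0" "G = at_top"
    then have "filterlim (\<lambda>x. - f x * inverse (deriv f x)) at_top F"
      by (intro filterlim_tendsto_pos_mult_at_top[OF tendsto_minus[OF lim(2)] _ inv]) auto
    then have "filterlim (\<lambda>x. x + - f x * inverse (deriv f x)) at_top F"
      by (rule filterlim_tendsto_add_at_top[OF lim(1)])
    then show ?thesis using \<open>G = _\<close> by (simp add: newton_approx_def[abs_def] divide_inverse)
  next
    assume "L > 0" "G = at_bot"
    then have "filterlim (\<lambda>x. f x * inverse (deriv f x)) at_top F"
      by (intro filterlim_tendsto_pos_mult_at_top[OF lim(2) _ inv]) auto
    then have "filterlim (\<lambda>x. - x + f x * inverse (deriv f x)) at_top F"
      by (rule filterlim_tendsto_add_at_top[OF tendsto_minus[OF lim(1)]])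
    then show ?thesis using \<open>G = _\<close>
      by (simp add: newton_approx_def[abs_def] divide_inverse filterlim_uminus_at_bot)
  qed
  {
    assume "filterlim f at_top G"
    from filterlim_compose[OF this N]
    have "filterlim (\<lambda>x. f x + f (newton_approx f x)) at_top F"
      by (rule filterlim_tendsto_add_at_top[OF lim(2)])
    \<comment> \<open>The limit is computed for the negated map, whose two summands are
      \<open>- x\<close> and a product of factors tending to \<open>at_top\<close>.\<close>
    from filterlim_tendsto_add_at_top[OF tendsto_minus[OF lim(1)] filterlim_at_top_mult_at_top[OF this inv]]
    show "filterlim (modified_newton_approx f) at_bot F"
      unfolding modified_newton_approx_alt[abs_def] filterlim_uminus_at_bot by simp
  }
  {
    assume "filterlim f at_bot G"
    from filterlim_compose[OF this N]
    have "filterlim (\<lambda>x. - f (newton_approx f x)) at_top F"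
      by (simp add: filterlim_uminus_at_bot)
    then have "filterlim (\<lambda>x. - f x + - f (newton_approx f x)) at_top F"
      by (rule filterlim_tendsto_add_at_top[OF tendsto_minus[OF lim(2)]])
    from filterlim_tendsto_add_at_top[OF lim(1) filterlim_at_top_mult_at_top[OF this inv]]
    show "filterlim (modified_newton_approx f) at_top F"
      unfolding modified_newton_approx_alt[abs_def] by (simp add: algebra_simps)
  }
qed

text \<open>Admitting both orientations makes the condition invariant under replacing
  \<open>f\<close> by \<open>- f\<close>.\<close>

definition opposite_infinite_limits :: "(real \<Rightarrow> real) \<Rightarrow> bool" where
  "opposite_infinite_limits f \<longleftrightarrow> (filterlim f at_top at_top \<and> filterlim f at_bot at_bot) \<or>
         (filterlim f at_bot at_top \<and> filterlim f at_top at_bot)"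

lemma opposite_infinite_limits_uminus:
  "opposite_infinite_limits (\<lambda>x. - f x) \<longleftrightarrow> opposite_infinite_limits f"
  by (auto simp: opposite_infinite_limits_def filterlim_uminus_at_bot)

text \<open>An increasing \<open>f\<close> with a root inside has opposite signs at \<open>c\<close>
  and \<open>d\<close>, so the Newton step escapes to \<open>at_top\<close> near \<open>c\<close>
  and to \<open>at_bot\<close> near \<open>d\<close>. The opposite limits of \<open>f\<close> then
  send the modified map to opposite infinities.\<close>

lemma modified_newton_unbounded_pos:
  fixes f :: "real \<Rightarrow> real"
  assumes diff: "\<And>x. f differentiable (at x)" and cont: "continuous_on UNIV (deriv f)"
    and lims: "opposite_infinite_limits f"
    and r: "c < r" "r < d" "f r = 0"
    and crit: "deriv f c = 0" "deriv f d = 0"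
    and pos: "\<And>x. c < x \<Longrightarrow> x < d \<Longrightarrow> deriv f x > 0"
  shows "\<exists>u\<in>{c<..<d}. \<exists>v\<in>{c<..<d}. modified_newton_approx f u \<le> p \<and> q \<le> modified_newton_approx f v"
proof -
  let ?M = "modified_newton_approx f"
  have D: "(f has_real_derivative deriv f x) (at x)" for x
    using diff by (simp add: DERIV_deriv_iff_real_differentiable)
  have contf: "continuous_on S f" for S
    using diff by (rule continuous_on_if_differentiable)
  have incr: "f a < f b" if "c \<le> a" "a < b" "b \<le> d" for a b
  proof (rule DERIV_pos_imp_increasing_open[OF that(2) _ contf])
    fix x assume "a < x" "x < b"
    then have "deriv f x > 0" using that pos by auto
    then show "\<exists>y. (f has_real_derivative y) (at x) \<and> y > 0" using D by blast
  qed
  have "f c < f r" "f r < f d" using incr[of c r] incr[of r d] r by auto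
  then have neg: "f c < 0" "f d > 0" using r by auto
  have tends: "(h \<longlongrightarrow> h x) (at x within S)" if "continuous_on UNIV h" for h :: "real \<Rightarrow> real" and x S
    using that by (meson UNIV_I continuous_on_def subset_UNIV tendsto_within_subset)
  have evc: "\<forall>\<^sub>F x in at_right c. x \<in> {c<..<d}" and evd: "\<forall>\<^sub>F x in at_left d. x \<in> {c<..<d}"
    using r eventually_at_right_real[of c d] eventually_at_left_real[of c d] by auto
  have posc: "\<forall>\<^sub>F x in at_right c. deriv f x > 0" using evc by eventually_elim (use pos in auto)
  have posd: "\<forall>\<^sub>F x in at_left d. deriv f x > 0" using evd by eventually_elim (use pos in auto)
  have dc: "(deriv f \<longlongrightarrow> 0) (at_right c)" "(deriv f \<longlongrightarrow> 0) (at_left d)"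
    using tends[OF cont] crit by metis+
  \<comment> \<open>Here \<open>L\<close> is \<open>f c\<close>, and \<open>f d\<close> in the next
    fact; their signs, found above, match the chosen \<open>G\<close>.\<close>
  note c = modified_newton_unbounded_near[OF tendsto_ident_at tends[OF contf] dc(1) posc, of at_top]
  note d = modified_newton_unbounded_near[OF tendsto_ident_at tends[OF contf] dc(2) posd, of at_bot]
  have low: "\<exists>u\<in>{c<..<d}. ?M u \<le> p"
    if "filterlim ?M at_bot F" "\<forall>\<^sub>F x in F. x \<in> {c<..<d}" "F \<noteq> bot" for F
  proof -
    have "\<forall>\<^sub>F x in F. ?M x \<le> p" using that(1) by (simp add: filterlim_at_bot)
    from eventually_happens'[OF that(3) eventually_conj[OF this that(2)]] show ?thesis by blast
  qed
  have high: "\<exists>v\<in>{c<..<d}. q \<le> ?M v"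
    if "filterlim ?M at_top F" "\<forall>\<^sub>F x in F. x \<in> {c<..<d}" "F \<noteq> bot" for F
  proof -
    have "\<forall>\<^sub>F x in F. q \<le> ?M x" using that(1) by (simp add: filterlim_at_top)
    from eventually_happens'[OF that(3) eventually_conj[OF this that(2)]] show ?thesis by blast
  qed
  have nb: "at_right c \<noteq> bot" "at_left d \<noteq> bot" by simp_all
  show ?thesis
    using lims unfolding opposite_infinite_limits_def
  proof (elim disjE conjE)
    assume "filterlim f at_top at_top" "filterlim f at_bot at_bot"
    then show ?thesis using low[OF c(1) evc nb(1)] high[OF d(2) evd nb(2)] neg by blast
  next
    assume "filterlim f at_bot at_top" "filterlim f at_top at_bot"
    then show ?thesis using high[OF c(2) evc nb(1)] low[OF d(1) evd nb(2)] neg by blast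
  qed
qed

text \<open>By connectedness the derivative has constant sign between the critical points; a
  negative sign is handled through \<open>- f\<close>.\<close>

lemma modified_newton_unbounded:
  fixes f :: "real \<Rightarrow> real"
  assumes diff: "\<And>x. f differentiable (at x)" and cont: "continuous_on UNIV (deriv f)"
    and lims: "opposite_infinite_limits f"
    and r: "c < r" "r < d" "f r = 0"
    and crit: "deriv f c = 0" "deriv f d = 0"
    and nz: "\<And>x. c < x \<Longrightarrow> x < d \<Longrightarrow> deriv f x \<noteq> 0"
  shows "\<exists>u\<in>{c<..<d}. \<exists>v\<in>{c<..<d}. modified_newton_approx f u \<le> p \<and> q \<le> modified_newton_approx f v"
proof -
  have "connected (deriv f ` {c<..<d})"
    by (intro connected_continuous_image continuous_on_subset[OF cont]) auto
  moreover have "0 \<notin> deriv f ` {c<..<d}" using nz by auto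
  ultimately have "(\<forall>x\<in>{c<..<d}. deriv f x > 0) \<or> (\<forall>x\<in>{c<..<d}. deriv f x < 0)"
    by (meson connectedD_interval image_eqI linorder_le_less_linear)
  then show ?thesis
  proof
    assume "\<forall>x\<in>{c<..<d}. deriv f x > 0"
    then show ?thesis using modified_newton_unbounded_pos[OF diff cont lims r crit] by simp
  next
    assume neg: "\<forall>x\<in>{c<..<d}. deriv f x < 0"
    note D = deriv_uminus[OF diff]
    have "\<exists>u\<in>{c<..<d}. \<exists>v\<in>{c<..<d}. modified_newton_approx (\<lambda>x. - f x) u \<le> p \<and>
        q \<le> modified_newton_approx (\<lambda>x. - f x) v"
    proof (rule modified_newton_unbounded_pos[where r = r])
      show "continuous_on UNIV (deriv (\<lambda>x. - f x))" unfolding D using cont by (intro continuous_intros)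
    qed (use diff lims r crit neg in \<open>auto simp: D opposite_infinite_limits_uminus\<close>)
    then show ?thesis using modified_newton_approx_uminus[OF diff] by simp
  qed
qed

lemma continuous_on_modified_newton:
  fixes f :: "real \<Rightarrow> real"
  assumes "continuous_on UNIV f" "continuous_on UNIV (deriv f)" "\<And>x. x \<in> S \<Longrightarrow> deriv f x \<noteq> 0"
  shows "continuous_on S (modified_newton_approx f)"
proof -
  note c = assms(1,2)[THEN continuous_on_subset, OF subset_UNIV[of S]]
  have "continuous_on S (newton_approx f)"
    unfolding newton_approx_def[abs_def]
    by (intro continuous_on_diff continuous_on_divide continuous_on_id c ballI assms(3))
  moreover from this have "continuous_on S (\<lambda>x. f (newton_approx f x))"
    by (rule continuous_on_compose2[OF assms(1) _ subset_UNIV])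
  ultimately show ?thesis
    unfolding modified_newton_approx_def[abs_def]
    by (intro continuous_on_diff continuous_on_divide c ballI assms(3))
qed

text \<open>A point with value at most \<open>p\<close> and one with value at least \<open>q\<close>
  span a compact interval free of critical points, where the intermediate value theorem
  applies.\<close>

lemma modified_newton_covering_interval:
  fixes f :: "real \<Rightarrow> real"
  assumes diff: "\<And>x. f differentiable (at x)" and cont: "continuous_on UNIV (deriv f)"
    and lims: "opposite_infinite_limits f"
    and r: "c < r" "r < d" "f r = 0"
    and crit: "deriv f c = 0" "deriv f d = 0"
    and nz: "\<And>x. c < x \<Longrightarrow> x < d \<Longrightarrow> deriv f x \<noteq> 0"
  shows "\<exists>a b. a \<le> b \<and> {a..b} \<subseteq> {c<..<d} \<and> continuous_on {a..b} (modified_newton_approx f) \<and>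
    {p..q} \<subseteq> modified_newton_approx f ` {a..b}"
proof -
  let ?M = "modified_newton_approx f"
  obtain u v where uv: "u \<in> {c<..<d}" "v \<in> {c<..<d}" "?M u \<le> p" "q \<le> ?M v"
    using modified_newton_unbounded[OF assms] by metis
  \<comment> \<open>Which of \<open>u\<close> and \<open>v\<close> lies further left depends on the
    signs of the derivative and of the limits of \<open>f\<close>.\<close>
  define a b where "a = min u v" and "b = max u v"
  have ab: "a \<le> b" "{a..b} \<subseteq> {c<..<d}" "u \<in> {a..b}" "v \<in> {a..b}"
    using uv by (auto simp: a_def b_def)
  have contf: "continuous_on UNIV f"
    using diff by (rule continuous_on_if_differentiable)
  have con: "continuous_on {a..b} ?M"
    using ab(2) nz by (intro continuous_on_modified_newton[OF contf cont]) auto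
  then have "connected (?M ` {a..b})" by (rule connected_continuous_image) simp
  then have "{?M u..?M v} \<subseteq> ?M ` {a..b}" using ab by (intro connected_contains_Icc) auto
  then have "{p..q} \<subseteq> ?M ` {a..b}" using uv by force
  then show ?thesis using ab con by blast
qed

section \<open>Critical points around the roots and construction of the horseshoe\<close>

text \<open>Rolle's theorem makes the compact set of critical points in \<open>{x..y}\<close>
  nonempty; \<open>c\<close> and \<open>d\<close> are its least and greatest elements, possibly
  equal. They differ from the end points because the roots are simple.\<close>

lemma extremal_critical_points_between_roots:
  fixes f :: "real \<Rightarrow> real"
  assumes diff: "\<And>x. f differentiable (at x)" and cont: "continuous_on UNIV (deriv f)"
    and "\<And>x. f x = 0 \<Longrightarrow> deriv f x \<noteq> 0" and "x < y" "f x = 0" "f y = 0"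
  shows "\<exists>c d. x < c \<and> c \<le> d \<and> d < y \<and> deriv f c = 0 \<and> deriv f d = 0 \<and>
    (\<forall>z. x \<le> z \<and> z < c \<longrightarrow> deriv f z \<noteq> 0) \<and> (\<forall>z. d < z \<and> z \<le> y \<longrightarrow> deriv f z \<noteq> 0)"
proof -
  define Z where "Z = {x..y} \<inter> deriv f -` {0}"
  have "continuous_on {x..y} (deriv f)" by (intro continuous_on_subset[OF cont]) auto
  then have "compact Z" unfolding Z_def by (rule compact_Icc_vimage_singleton)
  moreover have "Z \<noteq> {}"
  proof -
    have "continuous_on {x..y} f"
      using diff by (rule continuous_on_if_differentiable)
    then obtain z where "x < z" "z < y" "(f has_real_derivative 0) (at z)"
      using Rolle[of x y f] assms by (metis)
    then have "z \<in> Z" using DERIV_imp_deriv by (simp add: Z_def)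
    then show ?thesis by blast
  qed
  ultimately obtain c d where cd: "c \<in> Z" "\<forall>z\<in>Z. c \<le> z" "d \<in> Z" "\<forall>z\<in>Z. z \<le> d"
    using compact_attains_inf compact_attains_sup by metis
  have "c \<noteq> x" "d \<noteq> y" using assms cd by (auto simp: Z_def)
  then have "x < c" "c \<le> d" "d < y" "deriv f c = 0" "deriv f d = 0" using cd by (auto simp: Z_def)
  moreover have "deriv f z \<noteq> 0" if "x \<le> z" "z < c" for z
    using cd(1) bspec[OF cd(2), of z] that by (auto simp: Z_def)
  moreover have "deriv f z \<noteq> 0" if "d < z" "z \<le> y" for z
    using cd(3) bspec[OF cd(4), of z] that by (auto simp: Z_def)
  ultimately show ?thesis by blast
qed

lemma card_4_linorder_obtain:
  fixes R :: "'a::linorder set"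
  assumes "card R = 4"
  obtains w x y z where "w < x" "x < y" "y < z" "R = {w, x, y, z}"
proof -
  have fin: "finite R" using assms card.infinite by fastforce
  define xs where "xs = sorted_list_of_set R"
  have len: "length xs = 4" and xs: "sorted_wrt (<) xs" "set xs = R"
    using assms fin by (auto simp: xs_def)
  from len obtain w x y z where "xs = [w, x, y, z]"
    by (auto simp: numeral_eq_Suc length_Suc_conv)
  then show thesis using xs that by auto
qed

text \<open>The branches surround the two middle roots; the outer roots provide a critical point to
  the left of the one and to the right of the other.\<close>

lemma modified_newton_horseshoe:
  fixes f :: "real \<Rightarrow> real"
  assumes "newton_function f" "opposite_infinite_limits f" "R \<subseteq> {x. f x = 0}" "card R = 4"
  obtains lo hi :: "bool \<Rightarrow> real" where
    "\<And>k. lo k \<le> hi k"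
    "\<And>k. continuous_on {lo k..hi k} (modified_newton_approx f)"
    "\<And>k x. x \<in> {lo k..hi k} \<Longrightarrow> deriv f x \<noteq> 0"
    "\<And>k l. {lo k..hi k} \<subseteq> modified_newton_approx f ` {lo l..hi l}"
    "{lo True..hi True} \<inter> {lo False..hi False} = {}"
proof -
  have diff: "\<And>x. f differentiable (at x)" and nz: "\<And>x. f x = 0 \<Longrightarrow> deriv f x \<noteq> 0"
    and diff': "\<And>x. deriv f differentiable (at x)"
    using assms(1) by (auto simp: newton_function_def C2_def)
  have cont: "continuous_on UNIV (deriv f)"
    using diff' by (rule continuous_on_if_differentiable)
  obtain w x y z where "w < x" "x < y" "y < z" "R = {w, x, y, z}"
    using card_4_linorder_obtain assms(4) by metis
  then have root: "w < x" "x < y" "y < z" "f w = 0" "f x = 0" "f y = 0" "f z = 0"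
    using assms(3) by auto
  note crit = extremal_critical_points_between_roots[OF diff cont nz]
  obtain c1 where c1: "c1 < x" "deriv f c1 = 0" "\<And>t. c1 < t \<Longrightarrow> t \<le> x \<Longrightarrow> deriv f t \<noteq> 0"
    using crit[of w x] root by auto
  \<comment> \<open>\<open>d1\<close> and \<open>c2\<close> are the first and last critical points
    between the middle roots; \<open>d1 \<le> c2\<close> is what separates the two branches.\<close>
  obtain d1 c2 where d1: "x < d1" "deriv f d1 = 0" "\<And>t. x \<le> t \<Longrightarrow> t < d1 \<Longrightarrow> deriv f t \<noteq> 0"
    and c2: "c2 < y" "deriv f c2 = 0" "\<And>t. c2 < t \<Longrightarrow> t \<le> y \<Longrightarrow> deriv f t \<noteq> 0" and le: "d1 \<le> c2"
    using crit[of x y] root by auto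
  obtain d2 where d2: "y < d2" "deriv f d2 = 0" "\<And>t. y \<le> t \<Longrightarrow> t < d2 \<Longrightarrow> deriv f t \<noteq> 0"
    using crit[of y z] root by auto
  have nz1: "deriv f t \<noteq> 0" if "c1 < t" "t < d1" for t using c1(3) d1(3) that by (meson linear)
  have nz2: "deriv f t \<noteq> 0" if "c2 < t" "t < d2" for t using c2(3) d2(3) that by (meson linear)
  let ?M = "modified_newton_approx f"
  \<comment> \<open>The target \<open>{c1..d2}\<close> contains both branches, so it can be fixed
    before either branch is chosen.\<close>
  obtain a1 b1 where 1: "a1 \<le> b1" "{a1..b1} \<subseteq> {c1<..<d1}" "continuous_on {a1..b1} ?M"
      "{c1..d2} \<subseteq> ?M ` {a1..b1}"
    using modified_newton_covering_interval[OF diff cont assms(2) c1(1) d1(1) root(5) c1(2) d1(2) nz1]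
    by metis
  obtain a2 b2 where 2: "a2 \<le> b2" "{a2..b2} \<subseteq> {c2<..<d2}" "continuous_on {a2..b2} ?M"
      "{c1..d2} \<subseteq> ?M ` {a2..b2}"
    using modified_newton_covering_interval[OF diff cont assms(2) c2(1) d2(1) root(6) c2(2) d2(2) nz2]
    by metis
  define lo hi where "lo k = (if k then a1 else a2)" and "hi k = (if k then b1 else b2)" for k
  have in1: "c1 < a1" "b1 < d1" and in2: "c2 < a2" "b2 < d2" using 1 2 by auto
  have cov: "{c1..d2} \<subseteq> ?M ` {lo k..hi k}" for k using 1 2 by (auto simp: lo_def hi_def)
  have sub: "{lo k..hi k} \<subseteq> {c1..d2}" for k
    using in1 in2 le 1(1) 2(1) by (auto simp: lo_def hi_def)
  show thesis
  proof
    show "lo k \<le> hi k" for k using 1 2 by (simp add: lo_def hi_def)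
    show "continuous_on {lo k..hi k} ?M" for k using 1 2 by (simp add: lo_def hi_def)
    show "deriv f t \<noteq> 0" if "t \<in> {lo k..hi k}" for k t
      using that in1 in2 nz1 nz2 by (auto simp: lo_def hi_def split: if_splits)
    show "{lo k..hi k} \<subseteq> ?M ` {lo l..hi l}" for k l using cov sub by blast
    show "{lo True..hi True} \<inter> {lo False..hi False} = {}"
      using in1 in2 le by (auto simp: lo_def hi_def)
  qed
qed

section \<open>Periodic points and nonconvergent orbits of the modified Newton map\<close>

theorem theorem3p3:
  fixes f :: "real \<Rightarrow> real"
  assumes "newton_function f"
    and "(filterlim f at_top at_top \<and> filterlim f at_bot at_bot) \<or>
         (filterlim f at_bot at_top \<and> filterlim f at_top at_bot)"
    and "\<exists>R. R \<subseteq> {x. f x = 0} \<and> card R = 4"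
  shows "(\<forall>n\<ge>1. \<exists>a. has_prime_period f a n) \<and>
         uncountable {a. (\<forall>n. iterate_defined f n a) \<and>
                         \<not> convergent (\<lambda>n. (modified_newton_approx f ^^ n) a)}"
proof -
  let ?M = "modified_newton_approx f"
  have "opposite_infinite_limits f" using assms(2) by (simp add: opposite_infinite_limits_def)
  moreover obtain R where "R \<subseteq> {x. f x = 0}" "card R = 4" using assms(3) by blast
  ultimately obtain lo hi :: "bool \<Rightarrow> real" where
    le: "\<And>k. lo k \<le> hi k" and
    cont: "\<And>k. continuous_on {lo k..hi k} ?M" and
    nz: "\<And>k x. x \<in> {lo k..hi k} \<Longrightarrow> deriv f x \<noteq> 0" and
    cov: "\<And>k l. {lo k..hi k} \<subseteq> ?M ` {lo l..hi l}" and
    disj: "{lo True..hi True} \<inter> {lo False..hi False} = {}"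
    by (rule modified_newton_horseshoe[OF assms(1)]) blast
  have "\<exists>a. has_prime_period f a n" if "n \<ge> 1" for n
  proof -
    \<comment> \<open>The itinerary visits the first interval only at multiples of \<open>n\<close>, so no smaller period is possible.\<close>
    define s where "s i = (i = 0 \<or> i = n)" for i
    have "\<exists>x. (?M ^^ n) x = x \<and> (\<forall>i\<le>n. (?M ^^ i) x \<in> {lo (s i)..hi (s i)})"
      using cont cov le
      by (intro covering_cycle_periodic_point[of n "\<lambda>i. lo (s i)" "\<lambda>i. hi (s i)"]) (auto simp: s_def)
    then obtain x where x: "(?M ^^ n) x = x" "\<And>i. i \<le> n \<Longrightarrow> (?M ^^ i) x \<in> {lo (s i)..hi (s i)}"
      by blast
    have "iterate_defined f n x" using x(2) nz unfolding iterate_defined_def by (meson less_imp_le)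
    then have "has_period f x n" using that x by (simp add: has_period_def)
    moreover have "n \<le> m" if m: "has_period f x m" for m
    proof (rule ccontr)
      assume "\<not> n \<le> m"
      moreover have "m \<ge> 1" "(?M ^^ m) x = x" using m by (auto simp: has_period_def)
      \<comment> \<open>For \<open>1 \<le> m\<close> and \<open>m < n\<close>, the point
        \<open>x\<close>, equal to its iterate at time \<open>m\<close>, would lie in both disjoint
        intervals.\<close>
      ultimately show False using x(2)[of m] x(2)[of 0] disj by (auto simp: s_def)
    qed
    ultimately show ?thesis by (auto simp: has_prime_period_def)
  qed
  moreover have "uncountable {a. (\<forall>n. iterate_defined f n a) \<and> \<not> convergent (\<lambda>n. (?M ^^ n) a)}"
  proof -
    let ?J = "\<lambda>k. {lo k..hi k}"
    have "uncountable {x. (\<forall>i. (?M ^^ i) x \<in> ?J True \<union> ?J False) \<and> \<not> convergent (\<lambda>i. (?M ^^ i) x)}"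
      using le cont cov disj by (intro uncountable_nonconvergent_orbits) auto
    \<comment> \<open>Orbits confined to the two intervals never meet a critical point, so they are
      genuine orbits of the partial map.\<close>
    moreover have "iterate_defined f n x" if "\<forall>i. (?M ^^ i) x \<in> ?J True \<union> ?J False" for n x
      using that nz unfolding iterate_defined_def by blast
    ultimately show ?thesis by (elim contrapos_nn) (rule countable_subset, auto)
  qed
  ultimately show ?thesis by blast
qed

end
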